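(* Let $n$ be a non-negative integer and $m$ an integer with $0<n+m\le 2n+1$. Then $$\sum_{k=0}^{n+m}\frac{(-2)^k}{(n+m+k)(n-m+k+2)}\,\frac{\binom{n+m+k}{n+m-k}}{\binom{n-m+k+1}{k}}=\frac{1}{2(n+1)(n+m)}\sum_{k=0}^n(-1)^k\frac{\binom{n+m}{2k}}{\binom nk}.$$ In particular, for $n\ge1$, $$\sum_{k=0}^{n}\frac{(-2)^k}{(n+k)(n+k+1)(n+k+2)}\,\frac{\binom{n+k}{n-k}}{\binom{n+k}{k}}=\frac{1}{2n(n+1)^2}\sum_{k=0}^n(-1)^k\frac{\binom{n}{2k}}{\binom nk},$$ $$\sum_{k=0}^{2n}\frac{(-2)^k}{(2n+k)(k+1)(k+2)}\binom{2n+k}{2n-k}=\frac{1}{4n(n+1)}\sum_{k=0}^n(-1)^k\frac{\binom{2n}{2k}}{\binom nk}.$$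
   Context: Binomial coefficients $\binom{a}{b}$ with integers $0\le a<b$ are $0$. *)

theory Defs
  imports Complex_Main
begin

end

theory Submission
  imports Defs "HOL-Analysis.Henstock_Kurzweil_Integration"
begin

text \<open>
  Put \<open>p = n + m\<close> and \<open>r = 2n + 1 - p\<close>. Both sides, multiplied by \<open>p\<close>, equal the integral of
  \<open>T\<^sub>p(y) y\<^sup>r\<close> over the unit interval, where \<open>T\<^sub>p\<close> is the Chebyshev polynomial: expanding \<open>T\<^sub>p\<close> in
  powers of \<open>1 - y\<close> gives the left-hand side, and expanding it in the products
  \<open>(1 - y\<^sup>2)\<^sup>j y\<^bsup>p-2j\<^esup>\<close> gives the right-hand side, since each term is a beta integral whose
  value is a reciprocal binomial coefficient.
\<close>

section \<open>Beta integrals over the unit interval\<close>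

text \<open>Substituting \<open>u = y ^ Suc c\<close> turns the integral into the beta integral of
  \<open>(1 - u) ^ j * u ^ i\<close> divided by \<open>Suc c\<close>. The cases \<open>c = 0\<close>
  and \<open>c = 1\<close> serve the powers of \<open>1 - y\<close> and of
  \<open>1 - y\<^sup>2\<close>. The proof avoids the substitution: it works by induction on
  \<open>j\<close> with the factorial form of the value.\<close>

lemma has_integral_beta:
  fixes c i j :: nat
  shows "((\<lambda>y::real. (1 - y ^ Suc c) ^ j * y ^ (Suc c * i + c)) has_integral
           1 / (real (Suc c) * (real (i + j) + 1) * real ((i + j) choose j))) {0..1}"
proof -
  have "((\<lambda>y::real. (1 - y ^ Suc c) ^ j * y ^ (Suc c * i + c)) has_integral
           fact i * fact j / (real (Suc c) * fact (Suc (i + j)))) {0..1}"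
  proof (induction j arbitrary: i)
    case 0
    let ?e = "Suc c * Suc i"
    have "((\<lambda>y::real. y ^ (?e - 1)) has_integral 1 ^ ?e / real ?e - 0 ^ ?e / real ?e) {0..1}"
    proof (rule fundamental_theorem_of_calculus)
      fix x :: real
      show "((\<lambda>y. y ^ ?e / real ?e) has_vector_derivative x ^ (?e - 1)) (at x within {0..1})"
        unfolding has_real_derivative_iff_has_vector_derivative [symmetric]
        by (rule derivative_eq_intros refl | simp del: mult_Suc mult_Suc_right)+
    qed simp
    moreover have "?e - 1 = Suc c * i + c"
      by simp
    moreover have "1 ^ ?e / real ?e - 0 ^ ?e / real ?e
        = (fact i * fact 0 / (real (Suc c) * fact (Suc (i + 0))) :: real)"
      by (simp add: divide_simps del: of_nat_Suc) (simp add: algebra_simps)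
    ultimately show ?case
      by (simp add: add_ac)
  next
    case (Suc j)
    \<comment> \<open>Multiplying out one factor \<open>1 - y ^ Suc c\<close> leaves a difference of
      integrals with exponent \<open>j\<close>, at \<open>i\<close> and at \<open>Suc i\<close>;
      hence \<open>i\<close> is arbitrary in the induction.\<close>
    have "((\<lambda>y::real. (1 - y ^ Suc c) ^ j * y ^ (Suc c * i + c)
             - (1 - y ^ Suc c) ^ j * y ^ (Suc c * Suc i + c)) has_integral
           fact i * fact j / (real (Suc c) * fact (Suc (i + j)))
             - fact (Suc i) * fact j / (real (Suc c) * fact (Suc (Suc i + j)))) {0..1}"
      by (intro has_integral_diff Suc.IH)
    moreover have "(1 - y ^ Suc c) ^ j * y ^ (Suc c * i + c)
             - (1 - y ^ Suc c) ^ j * y ^ (Suc c * Suc i + c)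
        = (1 - y ^ Suc c) ^ Suc j * y ^ (Suc c * i + c)" for y :: real
      by (simp add: algebra_simps power_add)
    moreover have "fact i * fact j / (real (Suc c) * fact (Suc (i + j)))
             - fact (Suc i) * fact j / (real (Suc c) * fact (Suc (Suc i + j)))
        = (fact i * fact (Suc j) / (real (Suc c) * fact (Suc (i + Suc j))) :: real)"
    proof -
      \<comment> \<open>Here \<open>F\<close> stands for \<open>(i+j+1)!\<close>, \<open>I\<close>
        for \<open>i+1\<close> and \<open>J\<close> for \<open>j+1\<close>, so that
        \<open>(I + J) * F\<close> is \<open>(i+j+2)!\<close> and only a rational identity
        remains.\<close>
      have "A * B / (C * F) - (I * A) * B / (C * ((I + J) * F)) = A * (J * B) / (C * ((I + J) * F))"
        if "C > 0" "F > 0" "I > 0" "J > 0" for A B C F I J :: real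
        using that by (simp add: divide_simps) (simp add: algebra_simps)
      from this [of "real (Suc c)" "fact (Suc (i + j))" "real (Suc i)" "real (Suc j)" "fact i" "fact j"]
      have "fact i * fact j / (real (Suc c) * fact (Suc (i + j)))
          - (real (Suc i) * fact i) * fact j
            / (real (Suc c) * ((real (Suc i) + real (Suc j)) * fact (Suc (i + j))))
          = fact i * (real (Suc j) * fact j)
            / (real (Suc c) * ((real (Suc i) + real (Suc j)) * fact (Suc (i + j))))"
        by (simp del: fact_Suc of_nat_Suc)
      moreover have "(real (Suc i) + real (Suc j)) * fact (Suc (i + j)) = fact (Suc (Suc i + j))"
        "(real (Suc i) + real (Suc j)) * fact (Suc (i + j)) = fact (Suc (i + Suc j))"
        "real (Suc i) * fact i = fact (Suc i)" "real (Suc j) * fact j = fact (Suc j)"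
        by simp_all
      ultimately show ?thesis
        by metis
    qed
    ultimately show ?case
      by simp
  qed
  moreover have "fact i * fact j / (real (Suc c) * fact (Suc (i + j)))
      = 1 / (real (Suc c) * (real (i + j) + 1) * real ((i + j) choose j))"
    by (simp add: binomial_fact field_simps)
  ultimately show ?thesis
    by simp
qed

section \<open>Even part of a binomial expansion\<close>

lemma sum_even_eq:
  fixes f :: "nat \<Rightarrow> 'a::comm_monoid_add"
  shows "(\<Sum>k<2 * n. if even k then f k else 0) = (\<Sum>j<n. f (2 * j))"
  by (induction n) auto

lemma power_add_power_diff_eq_even_binomial_sum:
  fixes y t :: "'a::comm_ring_1"
  assumes "p \<le> 2 * n + 1"
  shows "(y + t) ^ p + (y - t) ^ p
    = 2 * (\<Sum>j\<le>n. of_nat (p choose (2 * j)) * (t\<^sup>2) ^ j * y ^ (p - 2 * j))"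
proof -
  \<comment> \<open>The range is padded to the even length \<open>2 * Suc n\<close>, as
    \<open>sum_even_eq\<close> demands. Since p < 2n+2, no term is lost and the added binomial
    coefficients vanish.\<close>
  have expand: "(y + s) ^ p = (\<Sum>k<2 * Suc n. of_nat (p choose k) * s ^ k * y ^ (p - k))" for s :: 'a
  proof -
    have "(y + s) ^ p = (\<Sum>k\<le>p. of_nat (p choose k) * s ^ k * y ^ (p - k))"
      by (subst add.commute) (rule binomial_ring)
    also have "\<dots> = (\<Sum>k<2 * Suc n. of_nat (p choose k) * s ^ k * y ^ (p - k))"
      using assms by (intro sum.mono_neutral_left) (simp_all add: binomial_eq_0 subset_iff)
    finally show ?thesis .
  qed
  have "(y + t) ^ p + (y - t) ^ p = (y + t) ^ p + (y + (- t)) ^ p"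
    by simp
  also have "\<dots> = (\<Sum>k<2 * Suc n.
      if even k then 2 * of_nat (p choose k) * t ^ k * y ^ (p - k) else 0)"
    unfolding expand sum.distrib [symmetric]
    by (intro sum.cong refl) (auto simp: algebra_simps)
  also have "\<dots> = (\<Sum>j<Suc n. 2 * of_nat (p choose (2 * j)) * t ^ (2 * j) * y ^ (p - 2 * j))"
    by (rule sum_even_eq)
  finally show ?thesis
    by (simp add: sum_distrib_left power_mult lessThan_Suc_atMost mult.assoc)
qed

section \<open>Morgan-Voyce polynomials\<close>

text \<open>These are the Morgan-Voyce polynomials usually written \<open>b\<^sub>p\<close>. They
  are set in a general commutative ring because they are later evaluated at complex
  arguments.\<close>

definition morgan_voyce :: "nat \<Rightarrow> 'a::comm_ring_1 \<Rightarrow> 'a" where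
  "morgan_voyce p x = (\<Sum>k\<le>p. of_nat ((p + k) choose (2 * k)) * x ^ k)"

lemma morgan_voyce_0 [simp]: "morgan_voyce 0 x = 1"
  by (simp add: morgan_voyce_def)

lemma morgan_voyce_1 [simp]: "morgan_voyce (Suc 0) x = 1 + x"
  by (simp add: morgan_voyce_def numeral_2_eq_2)

text \<open>Polynomials of different index can thus be compared coefficient by coefficient over one
  common range.\<close>

lemma morgan_voyce_extend:
  assumes "p \<le> N"
  shows "morgan_voyce p x = (\<Sum>k\<le>N. of_nat ((p + k) choose (2 * k)) * x ^ k)"
  unfolding morgan_voyce_def using assms by (intro sum.mono_neutral_left) (simp_all add: binomial_eq_0 subset_iff)

text \<open>Coefficientwise this is Pascal's rule applied three times, plus 1 = 2 - 1 for the
  constant coefficients.\<close>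

lemma morgan_voyce_rec:
  "morgan_voyce (Suc (Suc p)) x = (2 + x) * morgan_voyce (Suc p) x - morgan_voyce p x"
proof -
  define b where "b q k = (of_nat ((q + k) choose (2 * k)) :: 'a)" for q k
  have b0: "b q 0 = 1" for q
    by (simp add: b_def)
  have bS: "b (Suc (Suc p)) (Suc k) = 2 * b (Suc p) (Suc k) + b (Suc p) k - b p (Suc k)" for k
    by (simp add: b_def)
  \<comment> \<open>The constant term is split off because the multiplication by \<open>x\<close>
    shifts the coefficients by one, and the recurrence \<open>bS\<close> speaks only of positive
    indices.\<close>
  have S: "(\<Sum>k\<le>Suc (Suc p). b q k * x ^ k) = b q 0 + x * (\<Sum>k\<le>Suc p. b q (Suc k) * x ^ k)" for q
    by (subst sum.atMost_Suc_shift) (simp add: sum_distrib_left mult_ac del: sum.atMost_Suc)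
  have M: "morgan_voyce q x = b q 0 + x * (\<Sum>k\<le>Suc p. b q (Suc k) * x ^ k)" if "q \<le> Suc (Suc p)" for q
    unfolding S [symmetric] unfolding b_def using that by (rule morgan_voyce_extend)
  have "(\<Sum>k\<le>Suc p. b (Suc (Suc p)) (Suc k) * x ^ k)
      = 2 * (\<Sum>k\<le>Suc p. b (Suc p) (Suc k) * x ^ k) + (\<Sum>k\<le>Suc p. b (Suc p) k * x ^ k)
        - (\<Sum>k\<le>Suc p. b p (Suc k) * x ^ k)"
    unfolding bS by (simp add: algebra_simps sum.distrib sum_subtractf sum_distrib_left del: sum.atMost_Suc)
  also have "(\<Sum>k\<le>Suc p. b (Suc p) k * x ^ k) = morgan_voyce (Suc p) x"
    by (simp only: morgan_voyce_def b_def)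
  finally have "morgan_voyce (Suc (Suc p)) x = 1 + x * (2 * (\<Sum>k\<le>Suc p. b (Suc p) (Suc k) * x ^ k)
      + morgan_voyce (Suc p) x - (\<Sum>k\<le>Suc p. b p (Suc k) * x ^ k))"
    by (simp only: M [OF order_refl] b0)
  moreover have "x * (\<Sum>k\<le>Suc p. b q (Suc k) * x ^ k) = morgan_voyce q x - 1" if "q \<le> Suc (Suc p)" for q
    unfolding M [OF that] b0 by simp
  from this [of p] this [of "Suc p"]
  have "x * (\<Sum>k\<le>Suc p. b p (Suc k) * x ^ k) = morgan_voyce p x - 1"
    "x * (\<Sum>k\<le>Suc p. b (Suc p) (Suc k) * x ^ k) = morgan_voyce (Suc p) x - 1"
    by simp_all
  ultimately show ?thesis
    by (simp only: distrib_left distrib_right right_diff_distrib mult.left_commute [of x 2])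
      (simp add: algebra_simps)
qed

text \<open>With x = a + b - 2 the recurrence of the Morgan-Voyce polynomials has multiplier 2 + x =
  a + b. The power sums of \<open>a\<close> and \<open>b\<close> obey the same recurrence because
  \<open>a * b = 1\<close>, so the first two values decide.\<close>

lemma morgan_voyce_add_eq_power_add:
  fixes a b :: "'a::comm_ring_1"
  assumes "a * b = 1"
  shows "morgan_voyce (Suc p) (a + b - 2) + morgan_voyce p (a + b - 2) = a ^ Suc p + b ^ Suc p"
proof (induction p rule: induct_nat_012)
  case 0
  show ?case
    by simp
next
  case 1
  have "a ^ 2 + b ^ 2 = (a + b) * (a + b) - 2 * (a * b)"
    by (simp add: algebra_simps power2_eq_square)
  then show ?case
    using assms by (simp add: morgan_voyce_rec algebra_simps power2_eq_square)
next
  case (ge2 p)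
  have "a ^ Suc (Suc (Suc p)) + b ^ Suc (Suc (Suc p))
      = (a + b) * (a ^ Suc (Suc p) + b ^ Suc (Suc p)) - (a * b) * (a ^ Suc p + b ^ Suc p)"
    by (simp add: algebra_simps)
  then show ?case
    unfolding assms ge2 [symmetric] by (simp add: morgan_voyce_rec algebra_simps)
qed

section \<open>Two expansions of the Chebyshev polynomial\<close>

text \<open>Twice either side is \<open>(z + t) ^ p + (z - t) ^ p\<close> with
  \<open>t\<^sup>2 = z\<^sup>2 - 1\<close>, that is, twice the Chebyshev polynomial. The square root
  is taken in the complex numbers since \<open>y\<^sup>2 - 1\<close> is negative for 0 < y <
  1.\<close>

lemma chebyshev_sum_eq:
  fixes y :: real
  assumes "0 < p" and "p \<le> 2 * n + 1"
  shows "(\<Sum>k\<le>p. (-2) ^ k * (real p / real (p + k) * real ((p + k) choose (2 * k))) * (1 - y) ^ k)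
    = (\<Sum>j\<le>n. (-1) ^ j * real (p choose (2 * j)) * (1 - y\<^sup>2) ^ j * y ^ (p - 2 * j))"
    (is "?L = ?R")
proof -
  obtain q where q: "p = Suc q"
    using assms(1) gr0_conv_Suc by blast
  define z where "z = complex_of_real y"
  define t where "t = csqrt (z\<^sup>2 - 1)"
  have t2: "t\<^sup>2 = z\<^sup>2 - 1"
    by (simp add: t_def)
  have ab: "(z + t) * (z - t) = 1"
    using t2 by (simp add: algebra_simps power2_eq_square)
  have neg: "(z\<^sup>2 - 1) ^ j = (-1) ^ j * (1 - z\<^sup>2) ^ j" for j
    by (simp flip: power_mult_distrib)
  \<comment> \<open>The second binomial coefficient is (p-k)/(p+k) times the first, so the Chebyshev
    coefficient splits into those of two consecutive Morgan-Voyce polynomials.\<close>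
  have coeff: "real ((p + k) choose (2 * k)) + real ((q + k) choose (2 * k))
      = 2 * (real p / real (p + k) * real ((p + k) choose (2 * k)))" if "k \<le> p" for k
  proof -
    have "real (Suc (q + k) - 2 * k) * real (Suc (q + k) choose (2 * k))
        = real (Suc (q + k)) * real ((q + k) choose (2 * k))"
      unfolding of_nat_mult [symmetric] of_nat_eq_iff
      using binomial_absorb_comp [of "Suc (q + k)" "2 * k"] by simp
    moreover have "real (Suc (q + k) - 2 * k) = real p - real k"
      using that q by linarith
    ultimately show ?thesis
      by (simp add: q divide_simps) (simp add: algebra_simps)
  qed
  have "complex_of_real (2 * ?L) = of_real (\<Sum>k\<le>p. (real ((p + k) choose (2 * k))
      + real ((q + k) choose (2 * k))) * (-2 * (1 - y)) ^ k)"
    unfolding sum_distrib_left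
    by (intro arg_cong [of _ _ of_real] sum.cong refl) (subst coeff, simp_all only: power_mult_distrib mult_ac atMost_iff)
  \<comment> \<open>The argument fits because -2(1-y) = 2y - 2 and (z+t) + (z-t) = 2z.\<close>
  also have "\<dots> = morgan_voyce (Suc q) ((z + t) + (z - t) - 2) + morgan_voyce q ((z + t) + (z - t) - 2)"
    by (simp add: morgan_voyce_extend [of q p] morgan_voyce_def [of "Suc q"] q z_def
        distrib_right sum.distrib algebra_simps del: sum.atMost_Suc)
  also have "\<dots> = (z + t) ^ p + (z - t) ^ p"
    unfolding morgan_voyce_add_eq_power_add [OF ab] q ..
  also have "\<dots> = complex_of_real (2 * ?R)"
    unfolding power_add_power_diff_eq_even_binomial_sum [OF assms(2)] t2 neg
    by (simp add: z_def mult_ac)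
  finally show ?thesis
    unfolding of_real_eq_iff by simp
qed

section \<open>Comparison of the two integrals\<close>

lemma sum_binomial_quotient_eq:
  assumes "0 < p" and pr: "p + r = 2 * n + 1"
  shows "(\<Sum>k = 0..p. (-2) ^ k / ((real p + real k) * (real r + real k + 1))
           * (real ((p + k) choose (p - k)) / real ((r + k) choose k)))
    = 1 / (2 * (real n + 1) * real p)
      * (\<Sum>k = 0..n. (-1) ^ k * (real (p choose (2 * k)) / real (n choose k)))"
    (is "?L = _ * ?R")
proof -
  let ?c = "\<lambda>k. (-2) ^ k * (real p / real (p + k) * real ((p + k) choose (2 * k)))"
  let ?d = "\<lambda>j. (-1) ^ j * real (p choose (2 * j))"
  let ?f = "\<lambda>y::real. (\<Sum>k\<le>p. ?c k * (1 - y) ^ k) * y ^ r"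
  \<comment> \<open>Beta integrals with \<open>c = 0\<close>: the powers of \<open>1 - y\<close> are
    integrated against \<open>y ^ r\<close>.\<close>
  have "((\<lambda>y. \<Sum>k\<le>p. ?c k * ((1 - y ^ Suc 0) ^ k * y ^ (Suc 0 * r + 0))) has_integral
      (\<Sum>k\<le>p. ?c k * (1 / (real (Suc 0) * (real (r + k) + 1) * real ((r + k) choose k))))) {0..1}"
    by (intro has_integral_sum has_integral_mult_right has_integral_beta) simp
  moreover have "(\<lambda>y. \<Sum>k\<le>p. ?c k * ((1 - y ^ Suc 0) ^ k * y ^ (Suc 0 * r + 0))) = ?f"
    by (simp add: sum_distrib_right mult.assoc)
  moreover have "(\<Sum>k\<le>p. ?c k * (1 / (real (Suc 0) * (real (r + k) + 1) * real ((r + k) choose k))))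
      = real p * ?L"
    unfolding sum_distrib_left atMost_atLeast0
  proof (intro sum.cong refl)
    fix k assume "k \<in> {0..p}"
    then have "(p + k) choose (p - k) = (p + k) choose (2 * k)"
      by (subst binomial_symmetric) (auto simp: mult_2)
    then show "?c k * (1 / (real (Suc 0) * (real (r + k) + 1) * real ((r + k) choose k)))
      = real p * ((-2) ^ k / ((real p + real k) * (real r + real k + 1))
           * (real ((p + k) choose (p - k)) / real ((r + k) choose k)))"
      by (simp add: mult_ac)
  qed
  ultimately have L: "(?f has_integral real p * ?L) {0..1}"
    by simp
  \<comment> \<open>Beta integrals with \<open>c = 1\<close>: the exponent of y is (p - 2j) + r =
    2(n-j) + 1, and \<open>n - j + j\<close> collapses to \<open>n\<close>, which yields the factor
    1/(2(n+1)) common to all terms.\<close>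
  have "((\<lambda>y. \<Sum>j\<le>n. ?d j * ((1 - y ^ Suc 1) ^ j * y ^ (Suc 1 * (n - j) + 1))) has_integral
      (\<Sum>j\<le>n. ?d j * (1 / (real (Suc 1) * (real (n - j + j) + 1) * real ((n - j + j) choose j))))) {0..1}"
    by (intro has_integral_sum has_integral_mult_right has_integral_beta) simp
  moreover have "(\<Sum>j\<le>n. ?d j * ((1 - y ^ Suc 1) ^ j * y ^ (Suc 1 * (n - j) + 1))) = ?f y" for y :: real
  proof -
    have "?f y = (\<Sum>j\<le>n. ?d j * (1 - y\<^sup>2) ^ j * y ^ (p - 2 * j)) * y ^ r"
      using assms by (subst chebyshev_sum_eq [of p n]) auto
    also have "\<dots> = (\<Sum>j\<le>n. ?d j * ((1 - y ^ Suc 1) ^ j * y ^ (Suc 1 * (n - j) + 1)))"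
      unfolding sum_distrib_right
    proof (intro sum.cong refl)
      fix j
      show "?d j * (1 - y\<^sup>2) ^ j * y ^ (p - 2 * j) * y ^ r
          = ?d j * ((1 - y ^ Suc 1) ^ j * y ^ (Suc 1 * (n - j) + 1))"
      \<comment> \<open>If 2j > p, truncated subtraction makes the exponents disagree, but then
        \<open>p choose (2 * j)\<close> is 0.\<close>
      proof (cases "2 * j \<le> p")
        case True
        with pr have "Suc 1 * (n - j) + 1 = (p - 2 * j) + r"
          by (simp only: Suc_1)
        then show ?thesis
          by (simp add: power_add numeral_2_eq_2)
      qed simp
    qed
    finally show ?thesis ..
  qed
  moreover have "(\<Sum>j\<le>n. ?d j * (1 / (real (Suc 1) * (real (n - j + j) + 1) * real ((n - j + j) choose j))))
      = 1 / (2 * (real n + 1)) * ?R"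
    unfolding sum_distrib_left atMost_atLeast0 by (intro sum.cong refl) (simp add: field_simps)
  ultimately have "(?f has_integral 1 / (2 * (real n + 1)) * ?R) {0..1}"
    by simp
  with L have "real p * ?L = 1 / (2 * (real n + 1)) * ?R"
    by (rule has_integral_unique)
  moreover have "l = 1 / (2 * (real n + 1) * real p) * s"
    if "real p * l = 1 / (2 * (real n + 1)) * s" for l s :: real
  proof -
    have "l = real p * l / real p"
      using assms(1) by simp
    then show ?thesis
      unfolding that by simp
  qed
  ultimately show ?thesis
    by blast
qed

section \<open>Integer parameter and the two special cases\<close>

theorem theorem26:
  shows "(\<forall>(n::nat) (m::int). 0 < int n + m \<and> int n + m \<le> 2 * int n + 1 \<longrightarrow>
      (\<Sum>k = 0..nat (int n + m).
          (-2) ^ k / (of_int (int n + m + int k) * of_int (int n - m + int k + 2))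
          * (real (nat (int n + m + int k) choose nat (int n + m - int k))
             / real (nat (int n - m + int k + 1) choose k)))
      = 1 / (2 * (real n + 1) * of_int (int n + m))
        * (\<Sum>k = 0..n. (-1) ^ k * (real (nat (int n + m) choose (2 * k)) / real (n choose k))))
    \<and> (\<forall>n::nat. n \<ge> 1 \<longrightarrow>
      (\<Sum>k = 0..n.
          (-2) ^ k / ((real n + real k) * (real n + real k + 1) * (real n + real k + 2))
          * (real ((n + k) choose (n - k)) / real ((n + k) choose k)))
      = 1 / (2 * real n * (real n + 1)\<^sup>2)
        * (\<Sum>k = 0..n. (-1) ^ k * (real (n choose (2 * k)) / real (n choose k))))
    \<and> (\<forall>n::nat. n \<ge> 1 \<longrightarrow>
      (\<Sum>k = 0..2 * n.
          (-2) ^ k / ((2 * real n + real k) * (real k + 1) * (real k + 2))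
          * real ((2 * n + k) choose (2 * n - k)))
      = 1 / (4 * real n * (real n + 1))
        * (\<Sum>k = 0..n. (-1) ^ k * (real ((2 * n) choose (2 * k)) / real (n choose k))))"
proof (intro conjI allI impI)
  fix n :: nat and m :: int
  assume nm: "0 < int n + m \<and> int n + m \<le> 2 * int n + 1"
  \<comment> \<open>The bounds on n + m say exactly that p is positive and that n - m + 1 is
    non-negative, so both \<open>nat\<close> conversions are faithful.\<close>
  define p r where "p = nat (int n + m)" and "r = nat (int n - m + 1)"
  have p: "int n + m = int p" and r: "int n - m = int r - 1"
    using nm by (simp_all add: p_def r_def)
  have "nat (int r - 1 + int k + 1) = r + k" "nat (int p + int k) = p + k"
    "nat (int p - int k) = p - k" "of_int (int r - 1 + int k + 2) = real r + real k + 1" for k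
    by auto
  moreover have "0 < p" "p + r = 2 * n + 1"
    using nm p r by auto
  ultimately show "(\<Sum>k = 0..nat (int n + m).
          (-2) ^ k / (of_int (int n + m + int k) * of_int (int n - m + int k + 2))
          * (real (nat (int n + m + int k) choose nat (int n + m - int k))
             / real (nat (int n - m + int k + 1) choose k)))
      = 1 / (2 * (real n + 1) * of_int (int n + m))
        * (\<Sum>k = 0..n. (-1) ^ k * (real (nat (int n + m) choose (2 * k)) / real (n choose k)))"
    using sum_binomial_quotient_eq [of p r n] unfolding p r by (simp add: add_ac)
next
  fix n :: nat
  assume n: "n \<ge> 1"
  let ?R = "\<Sum>k = 0..n. (-1) ^ k * (real (n choose (2 * k)) / real (n choose k))"
  \<comment> \<open>Case m = 0, so p = n and r = n + 1. Rewriting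
    \<open>(n + 1 + k) choose k\<close> by \<open>(n + k) choose k\<close> brings in (n+k+1)/(n+1),
    the source of the third denominator factor and of the square of n + 1.\<close>
  have term_eq: "(-2) ^ k / ((real n + real k) * (real n + real k + 1) * (real n + real k + 2))
          * (real ((n + k) choose (n - k)) / real ((n + k) choose k))
      = 1 / (real n + 1) * ((-2) ^ k / ((real n + real k) * (real (n + 1) + real k + 1))
          * (real ((n + k) choose (n - k)) / real ((n + 1 + k) choose k)))" for k
  proof -
    have "real (n + 1) * real ((n + 1 + k) choose k) = real (n + 1 + k) * real ((n + k) choose k)"
      unfolding of_nat_mult [symmetric] of_nat_eq_iff
      using binomial_absorb_comp [of "n + 1 + k" k] by simp
    then have "real ((n + 1 + k) choose k) = (real n + real k + 1) * real ((n + k) choose k) / (real n + 1)"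
      by (simp add: field_simps)
    then show ?thesis
      by (simp add: add_ac)
  qed
  show "(\<Sum>k = 0..n.
          (-2) ^ k / ((real n + real k) * (real n + real k + 1) * (real n + real k + 2))
          * (real ((n + k) choose (n - k)) / real ((n + k) choose k)))
      = 1 / (2 * real n * (real n + 1)\<^sup>2) * ?R"
    unfolding term_eq sum_distrib_left [symmetric]
    using n by (subst sum_binomial_quotient_eq [of n "n + 1" n]) (auto simp: power2_eq_square)
next
  fix n :: nat
  assume n: "n \<ge> 1"
  \<comment> \<open>Case m = n, so p = 2n and r = 1; the factor k + 1 is
    \<open>(1 + k) choose k\<close>.\<close>
  have term_eq: "(-2) ^ k / ((2 * real n + real k) * (real k + 1) * (real k + 2))
          * real ((2 * n + k) choose (2 * n - k))
      = (-2) ^ k / ((real (2 * n) + real k) * (real 1 + real k + 1))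
          * (real ((2 * n + k) choose (2 * n - k)) / real ((1 + k) choose k))" for k
    by (simp add: add_ac)
  show "(\<Sum>k = 0..2 * n.
          (-2) ^ k / ((2 * real n + real k) * (real k + 1) * (real k + 2))
          * real ((2 * n + k) choose (2 * n - k)))
      = 1 / (4 * real n * (real n + 1))
        * (\<Sum>k = 0..n. (-1) ^ k * (real ((2 * n) choose (2 * k)) / real (n choose k)))"
    unfolding term_eq using n by (subst sum_binomial_quotient_eq [of "2 * n" 1 n]) auto
qed

end
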